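(* Let $\Gamma = (V,E)$ be a finite connected simple graph. Then $\Gamma$ is slide-equivalent to an almost regular graph.
   Context: A simple graph has no loops and no double edges; write $x \sim y$ if the vertices $x,y$ are joined by an edge $\overline{xy}$, and $d(x)$ for the degree of a vertex $x$. An (edge) slide on a graph $(V,E)$ is the following operation: given three distinct vertices $x,y,z \in V$ with $x \sim y \sim z$ and $x \not\sim z$, replace the edge $\overline{xy}$ by the edge $\overline{xz}$, so that the new graph is $(V, (E \setminus \{\overline{xy}\}) \cup \{\overline{xz}\})$. Two graphs $\Gamma$ and $\Sigma$ are slide-equivalent if there exists a finite (possibly empty) sequence of edge slides in $\Gamma$ which yields a graph $\widetilde{\Gamma}$ isomorphic to $\Sigma$. A graph with vertex set $V$ is almost regular if $\max_{x,y \in V} |d(x) - d(y)| \leq 1$. *)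

theory Defs
  imports Main
begin

text \<open>A graph is a pair (vertex set, edge set); the undirected edge joining \<open>x\<close> and \<open>y\<close> is
  the two-element set \<open>{x, y}\<close>.\<close>

type_synonym 'a graph = "'a set \<times> 'a set set"

abbreviation verts :: "'a graph \<Rightarrow> 'a set" where "verts \<equiv> fst"

abbreviation edges :: "'a graph \<Rightarrow> 'a set set" where "edges \<equiv> snd"

definition simple_graph :: "'a graph \<Rightarrow> bool" where
  "simple_graph G \<longleftrightarrow>
     (\<forall>e\<in>edges G. \<exists>x y. x \<in> verts G \<and> y \<in> verts G \<and> x \<noteq> y \<and> e = {x, y})"

definition adjacent :: "'a graph \<Rightarrow> 'a \<Rightarrow> 'a \<Rightarrow> bool" where
  "adjacent G x y \<longleftrightarrow> {x, y} \<in> edges G"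

definition degree :: "'a graph \<Rightarrow> 'a \<Rightarrow> nat" where
  "degree G x = card {y \<in> verts G. adjacent G x y}"

text \<open>The graph with no vertices counts as connected.\<close>

definition connected_graph :: "'a graph \<Rightarrow> bool" where
  "connected_graph G \<longleftrightarrow> (\<forall>x\<in>verts G. \<forall>y\<in>verts G. (adjacent G)\<^sup>*\<^sup>* x y)"

definition slide :: "'a graph \<Rightarrow> 'a graph \<Rightarrow> bool" where
  "slide G H \<longleftrightarrow>
     (\<exists>x\<in>verts G. \<exists>y\<in>verts G. \<exists>z\<in>verts G.
        x \<noteq> y \<and> y \<noteq> z \<and> x \<noteq> z \<and>
        adjacent G x y \<and> adjacent G y z \<and> \<not> adjacent G x z \<and>
        H = (verts G, (edges G - {{x, y}}) \<union> {{x, z}}))"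

definition isomorphic :: "'a graph \<Rightarrow> 'b graph \<Rightarrow> bool" where
  "isomorphic G H \<longleftrightarrow>
     (\<exists>f. bij_betw f (verts G) (verts H) \<and>
        (\<forall>x\<in>verts G. \<forall>y\<in>verts G. adjacent G x y \<longleftrightarrow> adjacent H (f x) (f y)))"

definition slide_equivalent :: "'a graph \<Rightarrow> 'b graph \<Rightarrow> bool" where
  "slide_equivalent G H \<longleftrightarrow> (\<exists>G'. slide\<^sup>*\<^sup>* G G' \<and> isomorphic G' H)"

text \<open>The bound on the maximum is stated pairwise, so that it is also meaningful when there are
  no vertices; the integers avoid truncated subtraction.\<close>

definition almost_regular :: "'a graph \<Rightarrow> bool" where
  "almost_regular G \<longleftrightarrow>
     (\<forall>x\<in>verts G. \<forall>y\<in>verts G. \<bar>int (degree G x) - int (degree G y)\<bar> \<le> 1)"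

end

theory Submission
  imports Defs
begin

text \<open>Sliding an edge at \<open>y\<close> over to a neighbour \<open>z\<close> moves one unit of degree from \<open>y\<close> to \<open>z\<close>.
  If \<open>d y > d z\<close>, such a slide is always available, because \<open>y\<close> has a neighbour that is not
  adjacent to \<open>z\<close>; it does not increase the sum of the squared degrees, and it decreases this sum
  if \<open>d y \<ge> d z + 2\<close>. If \<open>d u \<ge> d v + 2\<close> for two vertices that are far apart, follow a path from
  \<open>u\<close> to \<open>v\<close>: either two vertices closer together on it already have degree difference at least 2,
  or \<open>d u = d v + 2\<close> and the second vertex has degree \<open>d v + 1\<close>, and then a slide from \<open>u\<close> to it
  swaps the two degrees and shortens the path. So the sum can be decreased until the graph is almost
  regular.\<close>

lemma adjacent_commute: "adjacent G x y \<longleftrightarrow> adjacent G y x"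
  by (simp add: adjacent_def insert_commute)

lemma adjacentD:
  assumes "simple_graph G" "adjacent G x y"
  shows "x \<in> verts G" "y \<in> verts G" "x \<noteq> y"
proof -
  obtain a b where "a \<in> verts G" "b \<in> verts G" "a \<noteq> b" "{x, y} = {a, b}"
    using assms unfolding simple_graph_def adjacent_def by metis
  then show "x \<in> verts G" "y \<in> verts G" "x \<noteq> y"
    by (auto simp: doubleton_eq_iff)
qed

section \<open>Effect of a single slide on connectivity and degrees\<close>

definition slide_edge :: "'a graph \<Rightarrow> 'a \<Rightarrow> 'a \<Rightarrow> 'a \<Rightarrow> 'a graph" where
  "slide_edge G x y z = (verts G, (edges G - {{x, y}}) \<union> {{x, z}})"

lemma verts_slide_edge [simp]: "verts (slide_edge G x y z) = verts G"
  by (simp add: slide_edge_def)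

lemma adjacent_slide_edge:
  "adjacent (slide_edge G x y z) a b \<longleftrightarrow>
     adjacent G a b \<and> {a, b} \<noteq> {x, y} \<or> {a, b} = {x, z}"
  by (auto simp: slide_edge_def adjacent_def)

text \<open>Simplicity already separates the ends of an edge, but
  \<open>\<not> adjacent G x z\<close> also holds for \<open>x = z\<close>, so
  \<open>x \<noteq> z\<close> is assumed.\<close>

locale slidable =
  fixes G :: "'a graph" and x y z :: 'a
  assumes simple: "simple_graph G"
    and xy: "adjacent G x y" and yz: "adjacent G y z"
    and xz: "x \<noteq> z" "\<not> adjacent G x z"
begin

abbreviation H :: "'a graph" where "H \<equiv> slide_edge G x y z"

lemma vertices: "x \<in> verts G" "y \<in> verts G" "z \<in> verts G" "x \<noteq> y" "y \<noteq> z"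
  using adjacentD[OF simple xy] adjacentD[OF simple yz] by auto

lemma slide: "slide G H"
  using xy yz xz vertices unfolding slide_def slide_edge_def by blast

lemma simple_graph_slide: "simple_graph H"
  using simple vertices xz unfolding simple_graph_def slide_edge_def by auto

text \<open>The lost edge between \<open>x\<close> and \<open>y\<close> is replaced by the walk
  through \<open>z\<close>, which uses the new edge and the untouched edge from \<open>z\<close> to
  \<open>y\<close>.\<close>

lemma connected_graph_slide:
  assumes "connected_graph G"
  shows "connected_graph H"
proof -
  have step: "(adjacent H)\<^sup>*\<^sup>* a b" if "adjacent G a b" for a b
  proof (cases "{a, b} = {x, y}")
    case False
    then have "adjacent H a b" using that by (simp add: adjacent_slide_edge)
    then show ?thesis by blast
  next
    case True
    have "adjacent H x z" "adjacent H z x" "adjacent H z y" "adjacent H y z"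
      using yz xz vertices adjacent_commute[of G y z]
      by (auto simp: adjacent_slide_edge doubleton_eq_iff)
    then have "(adjacent H)\<^sup>*\<^sup>* x y" "(adjacent H)\<^sup>*\<^sup>* y x"
      by (meson converse_rtranclp_into_rtranclp r_into_rtranclp)+
    then show ?thesis using True by (auto simp: doubleton_eq_iff)
  qed
  have "(adjacent H)\<^sup>*\<^sup>* a b" if "(adjacent G)\<^sup>*\<^sup>* a b" for a b
    using that by induction (auto intro: step rtranclp_trans)
  then show ?thesis using assms by (auto simp: connected_graph_def)
qed

lemma degree_slide_source:
  assumes "finite (verts G)"
  shows "degree G y = Suc (degree H y)"
proof -
  have "{w \<in> verts G. adjacent H y w} = {w \<in> verts G. adjacent G y w} - {x}"
    using vertices xz by (auto simp: adjacent_slide_edge doubleton_eq_iff)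
  moreover have "x \<in> {w \<in> verts G. adjacent G y w}"
    using xy vertices adjacent_commute[of G x y] by auto
  ultimately show ?thesis
    using assms card_Suc_Diff1[of "{w \<in> verts G. adjacent G y w}" x] by (simp add: degree_def)
qed

lemma degree_slide_target:
  assumes "finite (verts G)"
  shows "degree H z = Suc (degree G z)"
proof -
  have "{w \<in> verts G. adjacent H z w} = insert x {w \<in> verts G. adjacent G z w}"
    using vertices xz by (auto simp: adjacent_slide_edge doubleton_eq_iff)
  moreover have "x \<notin> {w \<in> verts G. adjacent G z w}"
    using xz adjacent_commute[of G x z] by auto
  ultimately show ?thesis
    using assms by (simp add: degree_def)
qed

text \<open>The only delicate vertex is \<open>x\<close>, which trades its neighbour
  \<open>y\<close> for \<open>z\<close>.\<close>

lemma degree_slide_other: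
  assumes "finite (verts G)" "w \<noteq> y" "w \<noteq> z"
  shows "degree H w = degree G w"
proof (cases "w = x")
  case False
  then have "{v \<in> verts G. adjacent H w v} = {v \<in> verts G. adjacent G w v}"
    using assms by (auto simp: adjacent_slide_edge doubleton_eq_iff)
  then show ?thesis by (simp add: degree_def)
next
  case True
  let ?N = "{v \<in> verts G. adjacent G x v}"
  have "{v \<in> verts G. adjacent H x v} = insert z (?N - {y})"
    using vertices xz by (auto simp: adjacent_slide_edge doubleton_eq_iff)
  moreover have "y \<in> ?N" "z \<notin> ?N - {y}" "finite ?N" using xy xz vertices assms by auto
  ultimately have "card {v \<in> verts G. adjacent H x v} = card ?N"
    by (metis card_insert_disjoint card_Suc_Diff1 finite_Diff)
  then show ?thesis using True by (simp add: degree_def)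
qed

end

lemma slidable_exists:
  assumes "simple_graph G" "finite (verts G)" "adjacent G y z" "degree G z < degree G y"
  obtains x where "slidable G x y z"
proof -
  let ?N = "\<lambda>v. {w \<in> verts G. adjacent G v w}"
  have "y \<in> ?N z" "z \<in> ?N y"
    using adjacentD[OF assms(1,3)] assms(3) adjacent_commute[of G y z] by auto
  \<comment> \<open>Since \<open>y \<in> ?N z\<close>, subtracting one from both degrees truncates
    nothing and keeps the strict inequality.\<close>
  then have "card (?N z - {y}) < card (?N y - {z})"
    using assms(2,4) card_gt_0_iff[of "?N z"] by (auto simp: degree_def intro: diff_less_mono)
  then have "\<not> ?N y - {z} \<subseteq> ?N z - {y}"
    using assms(2) card_mono[of "?N z - {y}" "?N y - {z}"] by auto
  \<comment> \<open>The alternative \<open>x = y\<close> is ruled out below because there are no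
    loops.\<close>
  then obtain x where x: "adjacent G y x" "x \<noteq> z" "x \<in> verts G" "\<not> adjacent G z x \<or> x = y"
    by blast
  then have "slidable G x y z"
    using assms(1,3) adjacentD(3)[OF assms(1) x(1)] adjacent_commute[of G]
    by unfold_locales blast+
  then show ?thesis by (rule that)
qed

section \<open>The potential that slides decrease\<close>

definition degree_square_sum :: "'a graph \<Rightarrow> nat" where
  "degree_square_sum G = (\<Sum>v\<in>verts G. (degree G v)\<^sup>2)"

text \<open>With \<open>a\<close> and \<open>b\<close> the degrees of \<open>y\<close> and
  \<open>z\<close>, this is \<open>(a - 1)^2 + (b + 1)^2 = a^2 + b^2 - 2a + 2b + 2\<close>,
  rearranged to avoid subtraction on naturals.\<close>

lemma (in slidable) degree_square_sum_slide:
  assumes "finite (verts G)"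
  shows "degree_square_sum H + 2 * degree G y = degree_square_sum G + 2 * degree G z + 2"
proof -
  let ?R = "verts G - {y} - {z}"
  have split: "(\<Sum>v\<in>verts G. f v) = f y + (f z + (\<Sum>v\<in>?R. f v))" for f :: "'a \<Rightarrow> nat"
    using assms vertices by (simp add: sum.remove[of _ y] sum.remove[of _ z])
  have "(\<Sum>v\<in>?R. (degree H v)\<^sup>2) = (\<Sum>v\<in>?R. (degree G v)\<^sup>2)"
    using degree_slide_other[OF assms] by (intro sum.cong) auto
  then show ?thesis
    unfolding degree_square_sum_def verts_slide_edge split
    using degree_slide_source[OF assms] degree_slide_target[OF assms]
    by (simp add: power2_eq_square)
qed

section \<open>Descent along paths\<close>

lemma rtranclp_imp_distinct_path:
  assumes "R\<^sup>*\<^sup>* u v"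
  obtains ps where "successively R (u # ps)" "distinct (u # ps)" "last (u # ps) = v"
proof -
  from assms have "\<exists>ps. successively R (u # ps) \<and> distinct (u # ps) \<and> last (u # ps) = v"
  proof (induction rule: converse_rtranclp_induct)
    case base
    show ?case by (intro exI[of _ "[]"]) auto
  next
    case (step u w)
    then obtain ps where ps: "successively R (w # ps)" "distinct (w # ps)" "last (w # ps) = v"
      by blast
    show ?case
    proof (cases "u \<in> set (w # ps)")
      case False
      then show ?thesis using ps step by (intro exI[of _ "w # ps"]) auto
    next
      case True
      \<comment> \<open>If \<open>u\<close> recurs, the cycle is cut off: the path restarts at that
        occurrence.\<close>
      then obtain as bs where "w # ps = as @ u # bs" by (meson split_list)
      then show ?thesis using ps
        by (intro exI[of _ bs]) (metis distinct_append last_appendR list.distinct(1) successively_append_iff)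
    qed
  qed
  then show ?thesis using that by blast
qed

text \<open>Induction on the path with the graph arbitrary, since shortening the path may cost a
  slide. The invariants in the conclusion let the descent be iterated.\<close>

lemma slides_decrease_along_path:
  assumes "simple_graph G" "finite (verts G)" "connected_graph G"
    and "successively (adjacent G) (u # ps)" "distinct (u # ps)"
    and "degree G u \<ge> degree G (last (u # ps)) + 2"
  shows "\<exists>G'. slide\<^sup>*\<^sup>* G G' \<and> simple_graph G' \<and> verts G' = verts G \<and> connected_graph G' \<and>
    degree_square_sum G' < degree_square_sum G"
  using assms
proof (induction ps arbitrary: G u)
  case Nil
  then show ?case by simp
next
  case (Cons p ps)
  define v where "v = last (p # ps)"
  note fin = Cons.prems(2)
  have v: "v \<in> set (p # ps)" unfolding v_def by (rule last_in_set) simp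
  have up: "adjacent G u p" and path: "successively (adjacent G) (p # ps)"
    and dist: "distinct (p # ps)" and u: "u \<notin> set (p # ps)"
    and deg: "degree G u \<ge> degree G v + 2"
    using Cons.prems by (auto simp: v_def)
  show ?case
  proof (cases "degree G p \<ge> degree G v + 2")
    case True
    then show ?thesis using Cons.IH Cons.prems(1-3) path dist unfolding v_def by blast
  next
    case False
    then have less: "degree G p < degree G u" using deg by simp
    obtain x where "slidable G x u p"
      using slidable_exists[OF Cons.prems(1) fin up less] .
    then interpret slidable G x u p .
    note sum = degree_square_sum_slide[OF fin]
    show ?thesis
    proof (cases "degree G u \<ge> degree G p + 2")
      case True
      then have "degree_square_sum H < degree_square_sum G" using sum by simp
      then show ?thesis
        using slide simple_graph_slide connected_graph_slide Cons.prems(3)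
        by (intro exI[of _ H]) auto
    next
      case near: False
      then have eq: "degree G u = degree G p + 1" "degree G p = degree G v + 1"
        using deg less False by auto
      then have "v \<noteq> p" by auto
      moreover have "v \<noteq> u" using u v by blast
      \<comment> \<open>The slide raises \<open>p\<close> to degree \<open>d v + 2\<close> and
        leaves \<open>v\<close> alone, even if \<open>v\<close> is \<open>x\<close>.\<close>
      ultimately have "degree H p \<ge> degree H v + 2"
        using eq degree_slide_target[OF fin] degree_slide_other[OF fin] by simp
      \<comment> \<open>The removed edge contains \<open>u\<close>, which by distinctness is not on
        the remaining path.\<close>
      moreover have "successively (adjacent H) (p # ps)"
        using path
        by (rule successively_mono) (use u in \<open>auto simp: adjacent_slide_edge doubleton_eq_iff\<close>)
      ultimately obtain G' where "slide\<^sup>*\<^sup>* H G'" "simple_graph G'" "verts G' = verts G"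
        "connected_graph G'" "degree_square_sum G' < degree_square_sum H"
        using Cons.IH[of H p, folded v_def] simple_graph_slide connected_graph_slide Cons.prems(3)
          fin dist
        by auto
      moreover have "degree_square_sum H = degree_square_sum G" using sum eq by simp
      ultimately show ?thesis
        using slide by (metis converse_rtranclp_into_rtranclp)
    qed
  qed
qed

lemma slides_to_almost_regular:
  assumes "simple_graph G" "finite (verts G)" "connected_graph G"
  shows "\<exists>G'. slide\<^sup>*\<^sup>* G G' \<and> simple_graph G' \<and> almost_regular G'"
  using assms
proof (induction "degree_square_sum G" arbitrary: G rule: less_induct)
  case less
  show ?case
  proof (cases "almost_regular G")
    case True
    then show ?thesis using less.prems by blast
  next
    case False
    then obtain u v where uv: "u \<in> verts G" "v \<in> verts G" "degree G u \<ge> degree G v + 2"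
      unfolding almost_regular_def not_le by (force simp: abs_if not_less split: if_splits)
    then have "(adjacent G)\<^sup>*\<^sup>* u v" using less.prems by (simp add: connected_graph_def)
    then obtain ps where "successively (adjacent G) (u # ps)" "distinct (u # ps)"
      "last (u # ps) = v" by (rule rtranclp_imp_distinct_path)
    then obtain G' where "slide\<^sup>*\<^sup>* G G'" "simple_graph G'" "verts G' = verts G"
      "connected_graph G'" "degree_square_sum G' < degree_square_sum G"
      using slides_decrease_along_path[OF less.prems] uv(3) by metis
    then show ?thesis
      using less.hyps[of G'] less.prems(2) by (metis rtranclp_trans)
  qed
qed

theorem theorem4p2:
  fixes \<Gamma> :: "'a graph"
  assumes "simple_graph \<Gamma>" and "finite (verts \<Gamma>)" and "connected_graph \<Gamma>"
  shows "\<exists>\<Sigma> :: 'a graph. simple_graph \<Sigma> \<and> almost_regular \<Sigma> \<and> slide_equivalent \<Gamma> \<Sigma>"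
proof -
  obtain \<Sigma> where "slide\<^sup>*\<^sup>* \<Gamma> \<Sigma>" "simple_graph \<Sigma>" "almost_regular \<Sigma>"
    using slides_to_almost_regular[OF assms] by blast
  \<comment> \<open>The slides end in \<open>\<Sigma>\<close> itself, so the identity serves as
    isomorphism.\<close>
  moreover have "isomorphic \<Sigma> \<Sigma>"
    unfolding isomorphic_def by (intro exI[of _ id]) simp
  ultimately show ?thesis unfolding slide_equivalent_def by blast
qed

end
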